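(* Let $V$ and $U$ be two orbits of the same orbit type $T$, let $f:V\to U$ be their canonical mapping, and suppose $V\equiv_c U$. Let $\mathcal P$ be a faceting of $V$ which is noble under a symmetry of the orbit type, i.e. there is a point group $G$ acting transitively on every member of $T$ which acts on $\mathcal P$ by symmetries, transitively on its vertices and on its faces. Then $f(\mathcal P)$ (the abstract polyhedron of $\mathcal P$ with its realization composed with $f$) is a noble faceting of $U$.
   Context: **Polyhedra.** An abstract polyhedron is a poset with a minimum and a maximum element (the improper elements; all others are proper), such that every maximal chain has exactly $5$ elements (rank 3; in general rank = number of elements in a maximal chain minus 2), every section $\{h: x\le h\le y\}$ of rank 1 has exactly 4 elements, and every other section is connected (any two proper elements of the section are joined by a sequence of proper elements with consecutive ones comparable). Elements of rank 0, 1, 2 are vertices, edges, faces. A realization is a map from the vertices to $\mathbb{R}^3$. "Polyhedron" means an abstract polyhedron with a realization that is nondegenerate: it is finite; the realization is injective and no two edges and no two faces have the same vertex set; the vertices of each face are coplanar (their plane is the face plane); two faces sharing an edge never have the same face plane. A symmetry of $\mathcal P$ is a poset automorphism whose induced vertex permutation extends to an isometry of $\mathbb{R}^3$; $\mathcal P$ is noble if its symmetry group is transitive on vertices and on faces. $\mathcal P$ is a faceting of a point set $V$ if $V$ is its vertex set. **Orbit types.** Let $G_0$ be a reflection group $*332$, $*432$, $*532$ or $*22m$ ($m\ge2$) in $\mathbb{R}^3$ (orbifold notation), generated by reflections $r_1,r_2,r_3$ whose mirrors bound a fundamental domain: for $*332$, mirrors $x=y$, $x=-y$, $y=z$; for $*432$,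 mirrors $x=0$, $x=y$, $y=z$; for $*532$, mirrors $x=0$, $y=0$, $\phi x+y-\phi^{-1}z=0$ with $\phi=(1+\sqrt5)/2$; for $*22m$, mirrors $z=0$, $y=0$, and the plane through the $z$-axis at angle $\pi/m$ to $y=0$. Let $u_i$ be the vector in the closed fundamental domain lying on the two mirrors other than that of $r_i$, at distance 1 from the mirror of $r_i$. For $N$ a point group that is a normal subgroup of $G_0$, let $V_N(a,b,c)$ be the $N$-orbit of the generating point $au_1+bu_2+cu_3$. An orbit type $T$ is one of the families $V_N(a,b,1)$, $V_N(0,a,1)$, $V_N(a,0,1)$, $V_N(a,1,0)$, $V_N(0,0,1)$, $V_N(0,1,0)$, $V_N(1,0,0)$, with the parameters $a,b$ ranging over the positive reals (identical families are identified; families whose members are coplanar point sets are discarded). For $V,U\in T$ with generating points $p_V,p_U$, the canonical mapping $f:V\to U$ is the unique map with $f(g(p_V))=g(p_U)$ for all $g\in G$, where $G$ is any point group acting transitively on all members of $T$. **The relation $\equiv_c$.** All members of $T$ have the same number $k$ of points; enumerate each by a bijection $i_T:V\to\{1,\dots,k\}$ preserved by the canonical mappings. The volume configuration $\operatorname{Conf}_V:\{1,\dots,k\}^4\to\mathbb{R}$ sends $(i_T(v_0),\dots,i_T(v_3))$ to the determinant of the $4\times4$ matrix with rows $(v_{jx},v_{jy},v_{jz},1)$, $j=0,1,2,3$; its values are called entries. Write $V\ge_c U$ if whenever an entry of $\operatorname{Conf}_U$ is $0$, the corresponding entry (same index tuple) of $\operatorname{Conf}_V$ is also $0$; write $V\equiv_c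 U$ if $V\ge_c U$ and $U\ge_c V$. *)

theory Defs
  imports "HOL-Analysis.Analysis" "HOL-Algebra.Generated_Groups"
begin

section \<open>Polyhedra\<close>

text \<open>A poset is given by its order relation \<open>r\<close>; its elements are those of \<^term>\<open>Field r\<close>.\<close>

definition maximal_chain :: "('a \<times> 'a) set \<Rightarrow> 'a set \<Rightarrow> bool"
  where "maximal_chain r C \<longleftrightarrow> C \<in> Chains r \<and> (\<forall>D \<in> Chains r. C \<subseteq> D \<longrightarrow> D = C)"

definition has_rank :: "('a \<times> 'a) set \<Rightarrow> int \<Rightarrow> bool"
  where "has_rank r n \<longleftrightarrow> (\<forall>C. maximal_chain r C \<longrightarrow> finite C \<and> int (card C) - 2 = n)"

definition order_section :: "('a \<times> 'a) set \<Rightarrow> 'a \<Rightarrow> 'a \<Rightarrow> 'a set"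
  where "order_section r x y = {h. (x, h) \<in> r \<and> (h, y) \<in> r}"

definition section_connected :: "('a \<times> 'a) set \<Rightarrow> 'a \<Rightarrow> 'a \<Rightarrow> bool"
  where "section_connected r x y \<longleftrightarrow>
    (let Q = order_section r x y - {x, y}
     in \<forall>p \<in> Q. \<forall>q \<in> Q. (p, q) \<in> {(a, b). a \<in> Q \<and> b \<in> Q \<and> ((a, b) \<in> r \<or> (b, a) \<in> r)}\<^sup>*)"

definition abstract_polyhedron :: "('a \<times> 'a) set \<Rightarrow> bool"
  where "abstract_polyhedron r \<longleftrightarrow>
    Partial_order r \<and>
    (\<exists>bot \<in> Field r. \<forall>x \<in> Field r. (bot, x) \<in> r) \<and>
    (\<exists>top \<in> Field r. \<forall>x \<in> Field r. (x, top) \<in> r) \<and>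
    (\<forall>C. maximal_chain r C \<longrightarrow> card C = 5) \<and>
    (\<forall>x y. (x, y) \<in> r \<longrightarrow>
      (if has_rank (Restr r (order_section r x y)) 1 then card (order_section r x y) = 4
       else section_connected r x y))"

text \<open>The rank of an element \<open>x\<close> is the rank of the section between the minimum and \<open>x\<close>.\<close>

definition elements_of_rank :: "('a \<times> 'a) set \<Rightarrow> int \<Rightarrow> 'a set"
  where "elements_of_rank r n = {x \<in> Field r. has_rank (Restr r {h. (h, x) \<in> r}) n}"

abbreviation vertices :: "('a \<times> 'a) set \<Rightarrow> 'a set"
  where "vertices r \<equiv> elements_of_rank r 0"

abbreviation edges :: "('a \<times> 'a) set \<Rightarrow> 'a set"
  where "edges r \<equiv> elements_of_rank r 1"

abbreviation faces :: "('a \<times> 'a) set \<Rightarrow> 'a set"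
  where "faces r \<equiv> elements_of_rank r 2"

definition vertex_set :: "('a \<times> 'a) set \<Rightarrow> 'a \<Rightarrow> 'a set"
  where "vertex_set r x = {v \<in> vertices r. (v, x) \<in> r}"

definition plane :: "(real^3) set \<Rightarrow> bool"
  where "plane H \<longleftrightarrow> (\<exists>n c. n \<noteq> 0 \<and> H = {x. n \<bullet> x = c})"

definition coplanar :: "(real^3) set \<Rightarrow> bool"
  where "coplanar A \<longleftrightarrow> (\<exists>H. plane H \<and> A \<subseteq> H)"

text \<open>A realization is a map \<open>\<rho>\<close> of which only the values on the vertices matter. Being a
  face plane is a relation, since nothing in the definition of a polyhedron says that the
  vertices of a face are not collinear; whenever they are not, the plane is unique.\<close>

definition face_plane :: "('a \<times> 'a) set \<Rightarrow> ('a \<Rightarrow> real^3) \<Rightarrow> 'a \<Rightarrow> (real^3) set \<Rightarrow> bool"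
  where "face_plane r \<rho> F H \<longleftrightarrow> plane H \<and> \<rho> ` vertex_set r F \<subseteq> H"

definition nondegenerate :: "('a \<times> 'a) set \<Rightarrow> ('a \<Rightarrow> real^3) \<Rightarrow> bool"
  where "nondegenerate r \<rho> \<longleftrightarrow>
    finite (Field r) \<and>
    inj_on \<rho> (vertices r) \<and>
    inj_on (vertex_set r) (edges r) \<and>
    inj_on (vertex_set r) (faces r) \<and>
    (\<forall>F \<in> faces r. coplanar (\<rho> ` vertex_set r F)) \<and>
    (\<forall>E \<in> edges r. \<forall>F \<in> faces r. \<forall>F' \<in> faces r.
      F \<noteq> F' \<and> (E, F) \<in> r \<and> (E, F') \<in> r \<longrightarrow>
      \<not> (\<exists>H. face_plane r \<rho> F H \<and> face_plane r \<rho> F' H))"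

definition polyhedron :: "('a \<times> 'a) set \<Rightarrow> ('a \<Rightarrow> real^3) \<Rightarrow> bool"
  where "polyhedron r \<rho> \<longleftrightarrow> abstract_polyhedron r \<and> nondegenerate r \<rho>"

definition poset_automorphism :: "('a \<times> 'a) set \<Rightarrow> ('a \<Rightarrow> 'a) \<Rightarrow> bool"
  where "poset_automorphism r \<alpha> \<longleftrightarrow>
    bij_betw \<alpha> (Field r) (Field r) \<and>
    (\<forall>x \<in> Field r. \<forall>y \<in> Field r. (\<alpha> x, \<alpha> y) \<in> r \<longleftrightarrow> (x, y) \<in> r)"

definition isometry :: "(real^3 \<Rightarrow> real^3) \<Rightarrow> bool"
  where "isometry g \<longleftrightarrow> (\<forall>x y. dist (g x) (g y) = dist x y)"

definition symmetry_via ::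
    "('a \<times> 'a) set \<Rightarrow> ('a \<Rightarrow> real^3) \<Rightarrow> (real^3 \<Rightarrow> real^3) \<Rightarrow> ('a \<Rightarrow> 'a) \<Rightarrow> bool"
  where "symmetry_via r \<rho> g \<alpha> \<longleftrightarrow>
    isometry g \<and> poset_automorphism r \<alpha> \<and> (\<forall>v \<in> vertices r. \<rho> (\<alpha> v) = g (\<rho> v))"

definition symmetries :: "('a \<times> 'a) set \<Rightarrow> ('a \<Rightarrow> real^3) \<Rightarrow> ('a \<Rightarrow> 'a) set"
  where "symmetries r \<rho> = {\<alpha>. \<exists>g. symmetry_via r \<rho> g \<alpha>}"

definition noble :: "('a \<times> 'a) set \<Rightarrow> ('a \<Rightarrow> real^3) \<Rightarrow> bool"
  where "noble r \<rho> \<longleftrightarrow>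
    (\<forall>v \<in> vertices r. \<forall>w \<in> vertices r. \<exists>\<alpha> \<in> symmetries r \<rho>. \<alpha> v = w) \<and>
    (\<forall>F \<in> faces r. \<forall>F' \<in> faces r. \<exists>\<alpha> \<in> symmetries r \<rho>. \<alpha> F = F')"

text \<open>The automorphism by which \<open>g\<close> acts is unique on \<^term>\<open>Field r\<close> by nondegeneracy
  (elements are determined by their vertex sets), so the first conjunct does describe a
  group action.\<close>

definition noble_under ::
    "(real^3 \<Rightarrow> real^3) set \<Rightarrow> ('a \<times> 'a) set \<Rightarrow> ('a \<Rightarrow> real^3) \<Rightarrow> bool"
  where "noble_under G r \<rho> \<longleftrightarrow>
    (\<forall>g \<in> G. \<exists>\<alpha>. symmetry_via r \<rho> g \<alpha>) \<and>
    (\<forall>v \<in> vertices r. \<forall>w \<in> vertices r. \<exists>g \<in> G. \<exists>\<alpha>. symmetry_via r \<rho> g \<alpha> \<and> \<alpha> v = w) \<and>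
    (\<forall>F \<in> faces r. \<forall>F' \<in> faces r. \<exists>g \<in> G. \<exists>\<alpha>. symmetry_via r \<rho> g \<alpha> \<and> \<alpha> F = F')"

definition faceting :: "('a \<times> 'a) set \<Rightarrow> ('a \<Rightarrow> real^3) \<Rightarrow> (real^3) set \<Rightarrow> bool"
  where "faceting r \<rho> V \<longleftrightarrow> polyhedron r \<rho> \<and> \<rho> ` vertices r = V"


section \<open>Orbit types\<close>

text \<open>The group of isometries of space fixing the origin.\<close>

definition O3 :: "(real^3 \<Rightarrow> real^3) monoid"
  where "O3 = \<lparr>carrier = {f. orthogonal_transformation f}, monoid.mult = (\<circ>), one = id\<rparr>"

text \<open>Finiteness need not be required: the point groups used below are subgroups of finite
  reflection groups, or preserve a finite noncoplanar set.\<close>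

definition point_group :: "(real^3 \<Rightarrow> real^3) set \<Rightarrow> bool"
  where "point_group G \<longleftrightarrow> subgroup G O3"

datatype refl_type = Star332 | Star432 | Star532 | Star22 nat

definition golden :: real
  where "golden = (1 + sqrt 5) / 2"

text \<open>Normal vectors of the mirrors of \<open>r\<^sub>1\<close>, \<open>r\<^sub>2\<close>, \<open>r\<^sub>3\<close>, with signs chosen so that they
  point into a fundamental domain: respectively \<open>\<bar>x\<bar> \<le> y \<le> z\<close>, \<open>0 \<le> x \<le> y \<le> z\<close>,
  \<open>0 \<le> x, 0 \<le> y, \<phi>x + y \<le> z/\<phi>\<close>, and the dihedral wedge in \<open>0 \<le> z\<close> between the half-planes at
  angles \<open>0\<close> and \<open>\<pi>/m\<close> around the \<open>z\<close>-axis.\<close>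

fun normals :: "refl_type \<Rightarrow> (real^3)^3" where
  "normals Star332 = vector [vector [-1, 1, 0], vector [1, 1, 0], vector [0, -1, 1]]"
| "normals Star432 = vector [vector [1, 0, 0], vector [-1, 1, 0], vector [0, -1, 1]]"
| "normals Star532 = vector [vector [1, 0, 0], vector [0, 1, 0],
                             vector [- golden, -1, inverse golden]]"
| "normals (Star22 m) = vector [vector [0, 0, 1], vector [0, 1, 0],
                                vector [sin (pi / real m), - cos (pi / real m), 0]]"

definition mirror :: "refl_type \<Rightarrow> 3 \<Rightarrow> (real^3) set"
  where "mirror K i = {x. normals K $ i \<bullet> x = 0}"

definition fund_domain :: "refl_type \<Rightarrow> (real^3) set"
  where "fund_domain K = {x. \<forall>i. normals K $ i \<bullet> x \<ge> 0}"

definition reflection :: "refl_type \<Rightarrow> 3 \<Rightarrow> real^3 \<Rightarrow> real^3"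
  where "reflection K i x =
    x - (2 * (normals K $ i \<bullet> x) / (normals K $ i \<bullet> normals K $ i)) *\<^sub>R normals K $ i"

definition refl_group :: "refl_type \<Rightarrow> (real^3 \<Rightarrow> real^3) set"
  where "refl_group K = generate O3 (range (reflection K))"

definition corner :: "refl_type \<Rightarrow> 3 \<Rightarrow> real^3"
  where "corner K i = (THE u. u \<in> fund_domain K \<and> (\<forall>j. j \<noteq> i \<longrightarrow> u \<in> mirror K j) \<and>
                              infdist u (mirror K i) = 1)"

fun gen_point :: "refl_type \<Rightarrow> real \<times> real \<times> real \<Rightarrow> real^3"
  where "gen_point K (a, b, c) = a *\<^sub>R corner K 1 + b *\<^sub>R corner K 2 + c *\<^sub>R corner K 3"

definition point_orbit :: "(real^3 \<Rightarrow> real^3) set \<Rightarrow> real^3 \<Rightarrow> (real^3) set"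
  where "point_orbit N p = (\<lambda>g. g p) ` N"

definition parameter_sets :: "(real \<times> real \<times> real) set set"
  where "parameter_sets =
    {{(a, b, 1) | a b. a > 0 \<and> b > 0},
     {(0, a, 1) | a. a > 0}, {(a, 0, 1) | a. a > 0}, {(a, 1, 0) | a. a > 0},
     {(0, 0, 1)}, {(0, 1, 0)}, {(1, 0, 0)}}"

definition members ::
    "refl_type \<Rightarrow> (real^3 \<Rightarrow> real^3) set \<Rightarrow> (real \<times> real \<times> real) set \<Rightarrow> (real^3) set set"
  where "members K N S = {point_orbit N (gen_point K q) | q. q \<in> S}"

text \<open>An orbit type is handled through a presentation \<open>(K, N, S)\<close> of the family
  \<^term>\<open>members K N S\<close>.\<close>

definition orbit_type ::
    "refl_type \<Rightarrow> (real^3 \<Rightarrow> real^3) set \<Rightarrow> (real \<times> real \<times> real) set \<Rightarrow> bool"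
  where "orbit_type K N S \<longleftrightarrow>
    (\<forall>m. K = Star22 m \<longrightarrow> m \<ge> 2) \<and>
    point_group N \<and> N \<lhd> (O3\<lparr>carrier := refl_group K\<rparr>) \<and>
    S \<in> parameter_sets \<and>
    \<not> (\<forall>V \<in> members K N S. coplanar V)"

definition acts_transitively :: "(real^3 \<Rightarrow> real^3) set \<Rightarrow> (real^3) set \<Rightarrow> bool"
  where "acts_transitively G V \<longleftrightarrow>
    (\<forall>g \<in> G. g ` V = V) \<and> (\<forall>x \<in> V. \<forall>y \<in> V. \<exists>g \<in> G. g x = y)"

definition transitive_on_type ::
    "(real^3 \<Rightarrow> real^3) set \<Rightarrow> refl_type \<Rightarrow> (real^3 \<Rightarrow> real^3) set \<Rightarrow>
     (real \<times> real \<times> real) set \<Rightarrow> bool"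
  where "transitive_on_type G K N S \<longleftrightarrow>
    point_group G \<and> (\<forall>W \<in> members K N S. acts_transitively G W)"

text \<open>The map does not depend on the group \<open>G\<close> used to define it; \<open>N\<close> itself is one such
  group. Only the values of \<open>f\<close> on \<open>V\<close> matter.\<close>

definition canonical_map ::
    "refl_type \<Rightarrow> (real^3 \<Rightarrow> real^3) set \<Rightarrow> (real \<times> real \<times> real) set \<Rightarrow>
     (real^3) set \<Rightarrow> (real^3) set \<Rightarrow> (real^3 \<Rightarrow> real^3) \<Rightarrow> bool"
  where "canonical_map K N S V U f \<longleftrightarrow>
    f ` V \<subseteq> U \<and>
    (\<exists>q\<^sub>V \<in> S. \<exists>q\<^sub>U \<in> S. \<exists>G.
      V = point_orbit N (gen_point K q\<^sub>V) \<and> U = point_orbit N (gen_point K q\<^sub>U) \<and>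
      transitive_on_type G K N S \<and>
      (\<forall>g \<in> G. f (g (gen_point K q\<^sub>V)) = g (gen_point K q\<^sub>U)))"


section \<open>Volume configurations\<close>

definition enumeration ::
    "refl_type \<Rightarrow> (real^3 \<Rightarrow> real^3) set \<Rightarrow> (real \<times> real \<times> real) set \<Rightarrow>
     nat \<Rightarrow> ((real^3) set \<Rightarrow> real^3 \<Rightarrow> nat) \<Rightarrow> bool"
  where "enumeration K N S k \<iota> \<longleftrightarrow>
    (\<forall>V \<in> members K N S. bij_betw (\<iota> V) V {1..k}) \<and>
    (\<forall>V \<in> members K N S. \<forall>U \<in> members K N S. \<forall>f.
      canonical_map K N S V U f \<longrightarrow> (\<forall>v \<in> V. \<iota> U (f v) = \<iota> V v))"

text \<open>The index quadruple is a vector \<open>j\<close>; row \<open>s\<close> of the matrix is the point with number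
  \<open>j $ s\<close>, followed by 1.\<close>

definition homogeneous :: "real^3 \<Rightarrow> real^4"
  where "homogeneous v = vector [v $ 1, v $ 2, v $ 3, 1]"

definition conf :: "((real^3) set \<Rightarrow> real^3 \<Rightarrow> nat) \<Rightarrow> (real^3) set \<Rightarrow> nat^4 \<Rightarrow> real"
  where "conf \<iota> V j = det (\<chi> s. homogeneous (inv_into V (\<iota> V) (j $ s)))"

definition geq_c ::
    "nat \<Rightarrow> ((real^3) set \<Rightarrow> real^3 \<Rightarrow> nat) \<Rightarrow> (real^3) set \<Rightarrow> (real^3) set \<Rightarrow> bool"
  where "geq_c k \<iota> V U \<longleftrightarrow>
    (\<forall>j. (\<forall>s. j $ s \<in> {1..k}) \<longrightarrow> conf \<iota> U j = 0 \<longrightarrow> conf \<iota> V j = 0)"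

definition equiv_c ::
    "nat \<Rightarrow> ((real^3) set \<Rightarrow> real^3 \<Rightarrow> nat) \<Rightarrow> (real^3) set \<Rightarrow> (real^3) set \<Rightarrow> bool"
  where "equiv_c k \<iota> V U \<longleftrightarrow> geq_c k \<iota> V U \<and> geq_c k \<iota> U V"

end

theory Submission
  imports Defs
begin

text \<open>Two facts carry the proof.

  The first one is that the canonical mapping \<open>f\<close> commutes with every point group \<open>G\<close> that is
  transitive on all members of the orbit type, also when \<open>f\<close> was defined by means of another
  such group. The generating points of the members form a convex set \<open>P\<close>. Some member is
  finite and spans space, hence \<open>N\<close> is finite. A convex set covered by finitely many linear
  subspaces lies in one of them, so some point of \<open>P\<close> is generic: elements of \<open>N\<close> that agree at
  this point agree on all of \<open>P\<close>. Since all members have the same number of points, every point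
  of \<open>P\<close> has this property (lemma \<open>agree_at_one_imp_agree\<close>). By the same covering argument, each
  element of \<open>G\<close> agrees on \<open>P\<close> with an element of \<open>N\<close> (lemma \<open>transitive_group_agrees_with_orbit_group\<close>).
  So \<open>g p\<^sub>V \<mapsto> g p\<^sub>U\<close> is, for every such \<open>G\<close>, the same map as \<open>n p\<^sub>V \<mapsto> n p\<^sub>U\<close> with \<open>n \<in> N\<close>.
  Replacing \<open>\<rho>\<close> by \<open>f \<circ> \<rho>\<close> therefore keeps the isometries in \<open>G\<close> symmetries.

  The second one is that nondegeneracy can be expressed by coplanarity alone: two faces have a
  common face plane if and only if the union of their vertex sets is coplanar. A set is coplanar
  if and only if all determinants formed from four of its points vanish (lemma
  \<open>coplanar_iff_det\<close>). As \<open>f\<close> respects the numbering of the points, \<open>\<equiv>\<^sub>c\<close> says that \<open>f\<close> preserves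
  the vanishing of these determinants in both directions.\<close>

section \<open>Convex sets covered by subspaces\<close>

text \<open>If \<open>P\<close> lies neither in the subspace \<open>A\<close> nor in the union of the others, join a point \<open>x\<close>
  of \<open>P\<close> outside that union to a point \<open>y\<close> of \<open>P\<close> outside \<open>A\<close>. The line through them meets \<open>A\<close>
  in \<open>x\<close> only, so infinitely many of its points are distributed over the other subspaces, one of
  which contains two of them and hence \<open>x\<close>.\<close>

lemma convex_covered_by_subspaces:
  fixes P :: "'b::real_vector set"
  assumes "finite \<A>" "\<And>A. A \<in> \<A> \<Longrightarrow> subspace A" "convex P" "P \<noteq> {}" "P \<subseteq> \<Union>\<A>"
  shows "\<exists>A\<in>\<A>. P \<subseteq> A"
  using assms(1,2,5)
proof (induction \<A>)
  case empty
  then show ?case using assms(4) by auto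
next
  case (insert A \<A>)
  show ?case
  proof (rule ccontr)
    assume none: "\<not> ?case"
    have "\<not> P \<subseteq> \<Union>\<A>" using insert.IH insert.prems none by blast
    then obtain x where x: "x \<in> P" "x \<notin> \<Union>\<A>" by blast
    obtain y where y: "y \<in> P" "y \<notin> A" using none by blast
    have xA: "x \<in> A" using x insert.prems(2) by blast
    have sA: "subspace A" using insert.prems(1) by blast
    define z where "z t = (1 - t) *\<^sub>R x + t *\<^sub>R y" for t :: real
    have "\<exists>B\<in>\<A>. z t \<in> B" if t: "t \<in> {0<..1}" for t
    proof -
      have "z t \<in> P"
        unfolding z_def using assms(3) x(1) y(1) t by (intro convexD) auto
      moreover have "z t \<notin> A"
      proof
        assume "z t \<in> A"
        then have "(1/t) *\<^sub>R (z t - (1 - t) *\<^sub>R x) \<in> A"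
          by (intro subspace_scale[OF sA] subspace_diff[OF sA] xA)
        then show False using t y(2) by (simp add: z_def)
      qed
      ultimately show ?thesis using insert.prems(2) by blast
    qed
    then obtain b where b: "\<And>t. t \<in> {0<..1} \<Longrightarrow> b t \<in> \<A> \<and> z t \<in> b t" by metis
    have "\<not> inj_on b {0<..1::real}"
    proof
      assume "inj_on b {0<..1}"
      then have "finite {0<..1::real}"
        using b insert.hyps(1) by (meson inj_on_finite image_subsetI)
      then show False by (simp add: infinite_Ioc)
    qed
    then obtain s t where st: "s \<in> {0<..1}" "t \<in> {0<..1}" "b s = b t" "s \<noteq> t"
      by (auto simp: inj_on_def)
    have sB: "subspace (b t)" using b[OF st(2)] insert.prems(1) by blast
    have "(1/(s - t)) *\<^sub>R (s *\<^sub>R z t - t *\<^sub>R z s) \<in> b t"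
      using b[OF st(1)] b[OF st(2)] st(3)
      by (intro subspace_scale[OF sB] subspace_diff[OF sB]) auto
    moreover have "s *\<^sub>R z t - t *\<^sub>R z s = (s - t) *\<^sub>R x"
      by (simp add: z_def algebra_simps)
    ultimately have "x \<in> b t" using st(4) by simp
    then show False using x(2) b[OF st(2)] by blast
  qed
qed

lemma subspace_agreement:
  assumes "linear f" "linear g"
  shows "subspace {x. f x = g x}"
  using assms by (auto simp: subspace_def linear_0 linear_add linear_scale)

text \<open>Otherwise \<open>P\<close> would be covered by those of the finitely many agreement subspaces
  \<open>{x. n x = n' x}\<close> that do not contain \<open>P\<close>.\<close>

lemma exists_generic_point:
  fixes P :: "'b::real_vector set" and N :: "('b \<Rightarrow> 'c::real_vector) set"
  assumes "finite N" "\<And>n. n \<in> N \<Longrightarrow> linear n" "convex P" "P \<noteq> {}"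
  obtains p where "p \<in> P"
    "\<And>n n' x. \<lbrakk>n \<in> N; n' \<in> N; n p = n' p; x \<in> P\<rbrakk> \<Longrightarrow> n x = n' x"
proof -
  define \<A> where "\<A> = {A \<in> (\<lambda>(n, n'). {x. n x = n' x}) ` (N \<times> N). \<not> P \<subseteq> A}"
  have "finite \<A>" using assms(1) by (simp add: \<A>_def)
  moreover have "subspace A" if "A \<in> \<A>" for A
    using that assms(2) by (auto simp: \<A>_def intro: subspace_agreement)
  ultimately have "\<not> P \<subseteq> \<Union>\<A>"
    using convex_covered_by_subspaces[of \<A> P] assms(3,4) by (auto simp: \<A>_def)
  then obtain p where p: "p \<in> P" "p \<notin> \<Union>\<A>" by blast
  show ?thesis
  proof (rule that[OF p(1)])
    fix n n' x assume n: "n \<in> N" "n' \<in> N" "n p = n' p" "x \<in> P"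
    have "{x. n x = n' x} \<notin> \<A>" using p(2) n(3) by blast
    then show "n x = n' x" using n by (auto simp: \<A>_def)
  qed
qed

section \<open>Groups acting on the members of an orbit type\<close>

text \<open>For a generic point \<open>p\<^sub>0\<close>, the map \<open>n p\<^sub>0 \<mapsto> n p\<close> between orbits is well defined and onto;
  as the two orbits have the same finite number of points, it is injective.\<close>

lemma agree_at_one_imp_agree:
  assumes "finite N" "\<And>n. n \<in> N \<Longrightarrow> linear n" "convex P"
    and card: "\<And>p. p \<in> P \<Longrightarrow> card (point_orbit N p) = k"
    and p: "p \<in> P" "n \<in> N" "n' \<in> N" "n p = n' p" and x: "x \<in> P"
  shows "n x = n' x"
proof -
  obtain p\<^sub>0 where p\<^sub>0: "p\<^sub>0 \<in> P"
    and generic: "\<And>n n' x. \<lbrakk>n \<in> N; n' \<in> N; n p\<^sub>0 = n' p\<^sub>0; x \<in> P\<rbrakk> \<Longrightarrow> n x = n' x"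
    using exists_generic_point[of N P] assms(1-3) p(1) by blast
  define h where "h y = (SOME n. n \<in> N \<and> n p\<^sub>0 = y) p" for y
  have h: "h (m p\<^sub>0) = m p" if "m \<in> N" for m
  proof -
    have "(SOME n. n \<in> N \<and> n p\<^sub>0 = m p\<^sub>0) \<in> N \<and> (SOME n. n \<in> N \<and> n p\<^sub>0 = m p\<^sub>0) p\<^sub>0 = m p\<^sub>0"
      by (rule someI[of _ m]) (use that in simp)
    then show ?thesis unfolding h_def using generic that p(1) by blast
  qed
  have img: "h ` point_orbit N p\<^sub>0 = point_orbit N p"
    using h by (auto simp: point_orbit_def image_image)
  have "inj_on h (point_orbit N p\<^sub>0)"
    by (rule eq_card_imp_inj_on) (use assms(1) img card p(1) p\<^sub>0 in \<open>auto simp: point_orbit_def\<close>)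
  then have "n p\<^sub>0 = n' p\<^sub>0"
    using h p by (auto simp: point_orbit_def inj_on_def)
  then show ?thesis using generic p x by blast
qed

text \<open>At each point of \<open>P\<close>, \<open>g\<close> agrees with some element of the finite set \<open>N\<close>, so the
  agreement subspaces cover \<open>P\<close>.\<close>

lemma transitive_group_agrees_with_orbit_group:
  fixes N :: "(real^3 \<Rightarrow> real^3) set"
  assumes "finite N" "\<And>n. n \<in> N \<Longrightarrow> linear n" "convex P" "P \<noteq> {}"
    and g: "linear g" "\<And>p. p \<in> P \<Longrightarrow> g p \<in> point_orbit N p"
  obtains n where "n \<in> N" "\<And>x. x \<in> P \<Longrightarrow> g x = n x"
proof -
  have "\<exists>A\<in>(\<lambda>n. {x. g x = n x}) ` N. P \<subseteq> A"
    by (rule convex_covered_by_subspaces)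
      (use assms in \<open>auto simp: point_orbit_def intro: subspace_agreement\<close>)
  then show ?thesis using that by blast
qed

lemma point_groupD:
  assumes "point_group G"
  shows "g \<in> G \<Longrightarrow> linear g" "id \<in> G" "\<lbrakk>g \<in> G; h \<in> G\<rbrakk> \<Longrightarrow> g \<circ> h \<in> G"
proof -
  have G: "subgroup G O3" using assms by (simp add: point_group_def)
  show "g \<in> G \<Longrightarrow> linear g"
    using subgroup.subset[OF G] by (auto simp: O3_def orthogonal_transformation_linear)
  show "id \<in> G" using subgroup.one_closed[OF G] by (simp add: O3_def)
  show "\<lbrakk>g \<in> G; h \<in> G\<rbrakk> \<Longrightarrow> g \<circ> h \<in> G"
    using subgroup.m_closed[OF G] by (simp add: O3_def)
qed

text \<open>A set that does not span space lies in a plane through the origin.\<close>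

lemma span_noncoplanar:
  assumes "\<not> coplanar V"
  shows "span V = UNIV"
proof (rule ccontr)
  assume "span V \<noteq> UNIV"
  then obtain a where "a \<noteq> 0" "span V \<subseteq> {x. a \<bullet> x = 0}"
    using span_not_univ_subset_hyperplane by blast
  then have "coplanar V"
    unfolding coplanar_def plane_def using span_superset[of V] by blast
  then show False using assms by simp
qed

text \<open>The elements of \<open>N\<close> permute the spanning finite set \<open>V\<close>, and as linear maps they are
  determined by these permutations.\<close>

lemma finite_group_of_spanning_orbit:
  assumes "point_group N" "V = point_orbit N p" "finite V" "span V = UNIV"
  shows "finite N"
proof -
  have maps: "n x \<in> V" if "n \<in> N" "x \<in> V" for n x
  proof -
    obtain m where m: "m \<in> N" "x = m p"
      using \<open>x \<in> V\<close> unfolding assms(2) point_orbit_def by blast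
    have "(n \<circ> m) p \<in> V"
      unfolding assms(2) point_orbit_def
      by (rule imageI) (rule point_groupD(3)[OF assms(1) that(1) m(1)])
    then show ?thesis using m(2) by simp
  qed
  have "inj_on (\<lambda>n. restrict n V) N"
  proof (rule inj_onI)
    fix n n' assume n: "n \<in> N" "n' \<in> N" "restrict n V = restrict n' V"
    have eq: "n x = n' x" if "x \<in> V" for x
      using fun_cong[OF n(3), of x] that by simp
    then have "span V \<subseteq> {x. n x = n' x}"
      by (intro span_minimal subspace_agreement point_groupD(1)[OF assms(1)] n) auto
    then show "n = n'" unfolding assms(4) by blast
  qed
  moreover have "(\<lambda>n. restrict n V) ` N \<subseteq> (V \<rightarrow>\<^sub>E V)" using maps by auto
  ultimately show ?thesis
    by (rule inj_on_finite) (simp add: finite_PiE assms(3))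
qed

lemma convex_generating_points:
  assumes "S \<in> parameter_sets"
  shows "convex (gen_point K ` S)"
proof -
  have "linear (gen_point K)"
    by (rule linearI) (auto simp: algebra_simps)
  moreover have "convex S"
  proof -
    have "{(a, b, 1::real) | a b. a > 0 \<and> b > 0} = {0::real<..} \<times> {0::real<..} \<times> {1::real}"
      "{(0::real, a, 1::real) | a. a > 0} = {0} \<times> {0::real<..} \<times> {1}"
      "{(a, 0::real, 1::real) | a. a > 0} = {0::real<..} \<times> {0} \<times> {1}"
      "{(a, 1::real, 0::real) | a. a > 0} = {0::real<..} \<times> {1} \<times> {0}"
      by blast+
    then have "convex {(a, b, 1::real) | a b. (a::real) > 0 \<and> (b::real) > 0}"
      "convex {(0::real, a, 1::real) | a. (a::real) > 0}"
      "convex {(a, 0::real, 1::real) | a. (a::real) > 0}"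
      "convex {(a, 1::real, 0::real) | a. (a::real) > 0}"
      by (simp_all only: convex_Times convex_real_interval convex_singleton)
    then show ?thesis using assms unfolding parameter_sets_def
      by (elim insertE emptyE) (simp_all only: convex_singleton)
  qed
  ultimately show ?thesis by (rule convex_linear_image)
qed

lemma finite_orbit_group:
  assumes "orbit_type K N S" "enumeration K N S k \<iota>"
  shows "finite N"
proof -
  obtain W where W: "W \<in> members K N S" "\<not> coplanar W"
    using assms(1) by (auto simp: orbit_type_def)
  then obtain p where "W = point_orbit N p" by (auto simp: members_def)
  moreover have "finite W"
    using assms(2) W(1) bij_betw_finite[of "\<iota> W" W "{1..k}"] by (auto simp: enumeration_def)
  ultimately show ?thesis
    using finite_group_of_spanning_orbit span_noncoplanar[OF W(2)] assms(1)
    by (auto simp: orbit_type_def)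
qed

text \<open>The group \<open>G\<close> may differ from the group by which \<open>f\<close> is given; the two are compared by
  way of \<open>N\<close>.\<close>

lemma canonical_map_equivariant:
  assumes "orbit_type K N S" "enumeration K N S k \<iota>" "canonical_map K N S V U f"
    and "transitive_on_type G K N S" and "g \<in> G" "x \<in> V"
  shows "f (g x) = g (f x)"
proof -
  obtain q\<^sub>V q\<^sub>U H where q: "q\<^sub>V \<in> S" "q\<^sub>U \<in> S"
    and V: "V = point_orbit N (gen_point K q\<^sub>V)"
    and H: "transitive_on_type H K N S"
    and fH: "\<And>h. h \<in> H \<Longrightarrow> f (h (gen_point K q\<^sub>V)) = h (gen_point K q\<^sub>U)"
    using assms(3) unfolding canonical_map_def by blast
  define P where "P = gen_point K ` S"
  define p\<^sub>V where "p\<^sub>V = gen_point K q\<^sub>V"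
  define p\<^sub>U where "p\<^sub>U = gen_point K q\<^sub>U"
  have p: "p\<^sub>V \<in> P" "p\<^sub>U \<in> P" using q by (auto simp: P_def p\<^sub>V_def p\<^sub>U_def)
  have N: "point_group N" using assms(1) by (simp add: orbit_type_def)
  note lin = point_groupD(1)[OF N]
  have fin: "finite N" using finite_orbit_group[OF assms(1,2)] .
  have conv: "convex P"
    using convex_generating_points assms(1) by (auto simp: P_def orbit_type_def)
  have mem: "point_orbit N y \<in> members K N S" if "y \<in> P" for y
    using that unfolding members_def P_def by blast
  have self: "y \<in> point_orbit N y" for y
    unfolding point_orbit_def
    by (rule image_eqI[where x = id]) (simp_all add: point_groupD(2)[OF N])
  have card: "card (point_orbit N y) = k" if "y \<in> P" for y
  proof -
    have "bij_betw (\<iota> (point_orbit N y)) (point_orbit N y) {1..k}"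
      using assms(2) mem[OF that] unfolding enumeration_def by blast
    then show ?thesis by (auto dest: bij_betw_same_card)
  qed
  have trans: "acts_transitively L (point_orbit N y)"
    if "transitive_on_type L K N S" "y \<in> P" for L y
    using that(1) mem[OF that(2)] unfolding transitive_on_type_def by blast
  have agree: "\<exists>n\<in>N. \<forall>y\<in>P. h y = n y"
    if L: "transitive_on_type L K N S" "h \<in> L" for L h
  proof -
    have "linear h"
      using L point_groupD(1)[of L h] by (simp add: transitive_on_type_def)
    moreover have "h y \<in> point_orbit N y" if "y \<in> P" for y
    proof -
      have "h ` point_orbit N y = point_orbit N y"
        using trans[OF L(1) that] L(2) by (simp add: acts_transitively_def)
      then show ?thesis using self[of y] by blast
    qed
    ultimately obtain n where "n \<in> N" "\<And>y. y \<in> P \<Longrightarrow> h y = n y"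
      using transitive_group_agrees_with_orbit_group[OF fin lin conv, of h] p(1) by blast
    then show ?thesis by blast
  qed
  have reach: "\<exists>h\<in>L. h p\<^sub>V = y" if "transitive_on_type L K N S" "y \<in> V" for L y
    using trans[OF that(1) p(1)] self[of p\<^sub>V] that(2)
    unfolding acts_transitively_def V p\<^sub>V_def by simp
  have fN: "f (n p\<^sub>V) = n p\<^sub>U" if n: "n \<in> N" for n
  proof -
    have "n p\<^sub>V \<in> V" unfolding V point_orbit_def p\<^sub>V_def using n by (rule imageI)
    then obtain h where h: "h \<in> H" "h p\<^sub>V = n p\<^sub>V" using reach[OF H] by blast
    obtain n' where n': "n' \<in> N" "\<forall>y\<in>P. h y = n' y" using agree[OF H h(1)] by blast
    have "n' p\<^sub>V = n p\<^sub>V" using n'(2) p(1) h(2) by simp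
    then have "n' p\<^sub>U = n p\<^sub>U"
      using agree_at_one_imp_agree[OF fin lin conv card p(1) n'(1) n] p(2) by simp
    then have "h p\<^sub>U = n p\<^sub>U" using n'(2) p(2) by simp
    moreover have "f (h p\<^sub>V) = h p\<^sub>U" using fH[OF h(1)] by (simp add: p\<^sub>V_def p\<^sub>U_def)
    ultimately show ?thesis using h(2) by simp
  qed
  have fG: "f (h p\<^sub>V) = h p\<^sub>U" if h: "h \<in> G" for h
  proof -
    obtain n where n: "n \<in> N" "\<forall>y\<in>P. h y = n y" using agree[OF assms(4) h] by blast
    then show ?thesis using fN[OF n(1)] p by simp
  qed
  obtain h where h: "h \<in> G" "x = h p\<^sub>V" using reach[OF assms(4,6)] by blast
  have "g \<circ> h \<in> G"
    using point_groupD(3)[of G g h] assms(4,5) h(1) by (simp add: transitive_on_type_def)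
  from fG[OF this] fG[OF h(1)] show ?thesis using h(2) by simp
qed

text \<open>The bijectivity comes from the numbering: \<open>f\<close> is \<open>\<iota> U\<close> inverted after \<open>\<iota> V\<close>.\<close>

lemma canonical_map_bij:
  assumes "V \<in> members K N S" "U \<in> members K N S"
    and "canonical_map K N S V U f" "enumeration K N S k \<iota>"
  shows "bij_betw f V U"
proof -
  have bV: "bij_betw (\<iota> V) V {1..k}" and bU: "bij_betw (\<iota> U) U {1..k}"
    and num: "\<And>v. v \<in> V \<Longrightarrow> \<iota> U (f v) = \<iota> V v"
    using assms unfolding enumeration_def by blast+
  have fVU: "f ` V \<subseteq> U" using assms(3) by (simp add: canonical_map_def)
  have "bij_betw (\<iota> U \<circ> f) V {1..k}"
    using bV num by (simp cong: bij_betw_cong)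
  then show ?thesis using bij_betw_comp_iff2[OF bU fVU] by simp
qed

section \<open>Coplanarity and volume configurations\<close>

lemma vector_4_nth:
  "(vector [w, x, y, z] :: 'b::zero^4) $ 1 = w"
  "(vector [w, x, y, z] :: 'b::zero^4) $ 2 = x"
  "(vector [w, x, y, z] :: 'b::zero^4) $ 3 = y"
  "(vector [w, x, y, z] :: 'b::zero^4) $ 4 = z"
  by (simp_all add: vector_def)

lemma homogeneous_inner:
  "homogeneous v \<bullet> w = v $ 1 * w $ 1 + v $ 2 * w $ 2 + v $ 3 * w $ 3 + w $ 4"
  by (simp add: homogeneous_def inner_vec_def sum_4 vector_4_nth)

text \<open>The points of a plane are those whose homogeneous coordinates are annihilated by some
  \<open>(n, - c)\<close> with \<open>n \<noteq> 0\<close>; on a nonempty set, a nonzero annihilating vector always has this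
  form. If there is none, the homogeneous coordinates of the set span the space of dimension 4,
  so those of some four points form a basis.\<close>

lemma coplanar_iff_det:
  "coplanar A \<longleftrightarrow> (\<forall>v :: (real^3)^4. (\<forall>s. v $ s \<in> A) \<longrightarrow> det (\<chi> s. homogeneous (v $ s)) = 0)"
  (is "_ \<longleftrightarrow> ?R")
proof
  assume "coplanar A"
  then obtain n c where nc: "n \<noteq> 0" "A \<subseteq> {x. n \<bullet> x = c}"
    by (auto simp: coplanar_def plane_def)
  define w :: "real^4" where "w = vector [n $ 1, n $ 2, n $ 3, - c]"
  have w0: "w \<noteq> 0" using nc(1) by (auto simp: w_def vec_eq_iff forall_3 forall_4 vector_4_nth)
  show ?R
  proof (intro allI impI)
    fix v :: "(real^3)^4" assume v: "\<forall>s. v $ s \<in> A"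
    have "homogeneous (v $ s) \<bullet> w = 0" for s
    proof -
      have "n \<bullet> v $ s = c" using v nc(2) by blast
      then have "n $ 1 * v $ s $ 1 + n $ 2 * v $ s $ 2 + n $ 3 * v $ s $ 3 = c"
        by (simp add: inner_vec_def sum_3)
      then show ?thesis
        by (simp add: homogeneous_inner w_def vector_4_nth mult.commute)
    qed
    then have "(\<chi> s. homogeneous (v $ s)) *v w = 0"
      by (simp add: matrix_vector_mul_component vec_eq_iff)
    then show "det (\<chi> s. homogeneous (v $ s)) = 0"
      using w0 invertible_det_nz matrix_left_invertible_ker invertible_left_inverse by metis
  qed
next
  assume R: ?R
  show "coplanar A"
  proof (cases "A = {}")
    case True
    have "(axis 1 1 :: real^3) \<noteq> 0" by (simp add: axis_eq_0_iff)
    then have "plane {x. (axis 1 1 :: real^3) \<bullet> x = 0}" unfolding plane_def by blast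
    then show ?thesis using True by (auto simp: coplanar_def)
  next
    case False
    have "span (homogeneous ` A) \<noteq> UNIV"
    proof
      assume sp: "span (homogeneous ` A) = UNIV"
      obtain B where B: "B \<subseteq> homogeneous ` A" "independent B" "homogeneous ` A \<subseteq> span B"
        using maximal_independent_subset[of "homogeneous ` A"] by blast
      have spB: "span B = UNIV"
        using sp B(3) span_mono span_span by blast
      then have "card B = CARD(4)"
        using B(2) dim_eq_card[of B UNIV] dim_UNIV[where 'a="real^4"] by simp
      then obtain b where b: "bij_betw b (UNIV::4 set) B"
        using finite_same_card_bij[of "UNIV :: 4 set" B] independent_imp_finite[OF B(2)] by auto
      then have "\<forall>s. \<exists>v\<in>A. b s = homogeneous v"
        using B(1) by (auto simp: bij_betw_def)
      then obtain v where v: "\<And>s. v s \<in> A" "\<And>s. b s = homogeneous (v s)" by metis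
      have "rows (\<chi> s. homogeneous (v s)) = B"
        using b v(2) by (auto simp: rows_def row_def bij_betw_def image_def vec_lambda_eta)
      then have "det (\<chi> s. homogeneous (v s)) \<noteq> 0"
        using spB matrix_left_invertible_span_rows invertible_left_inverse invertible_det_nz
        by metis
      then show False using R[rule_format, of "\<chi> s. v s"] v(1) by simp
    qed
    then obtain w where w: "w \<noteq> 0" "span (homogeneous ` A) \<subseteq> {x. w \<bullet> x = 0}"
      using span_not_univ_subset_hyperplane by blast
    have ker: "homogeneous x \<bullet> w = 0" if "x \<in> A" for x
      using w(2) that span_base[of "homogeneous x" "homogeneous ` A"]
      by (auto simp: inner_commute)
    define n :: "real^3" where "n = vector [w $ 1, w $ 2, w $ 3]"
    have inner: "n \<bullet> x = - w $ 4" if "x \<in> A" for x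
    proof -
      have "n \<bullet> x = x $ 1 * w $ 1 + x $ 2 * w $ 2 + x $ 3 * w $ 3"
        by (simp add: n_def inner_vec_def sum_3 mult.commute)
      then show ?thesis using ker[OF that] by (simp add: homogeneous_inner)
    qed
    have "n \<noteq> 0"
    proof
      assume "n = 0"
      then have "w = 0"
        using False inner by (force simp: n_def vec_eq_iff forall_3 forall_4)
      then show False using w(1) by simp
    qed
    then show ?thesis using inner unfolding coplanar_def plane_def by blast
  qed
qed

lemma equiv_c_det:
  assumes "equiv_c k \<iota> V U"
    and bV: "bij_betw (\<iota> V) V {1..k}" and bU: "bij_betw (\<iota> U) U {1..k}"
    and f: "f ` V \<subseteq> U" "\<And>v. v \<in> V \<Longrightarrow> \<iota> U (f v) = \<iota> V v"
    and v: "\<And>s. v $ s \<in> V"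
  shows "det (\<chi> s. homogeneous (f (v $ s))) = 0 \<longleftrightarrow> det (\<chi> s. homogeneous (v $ s)) = 0"
proof -
  define j :: "nat^4" where "j = (\<chi> s. \<iota> V (v $ s))"
  have j: "\<forall>s. j $ s \<in> {1..k}" using bV v by (auto simp: j_def bij_betw_def)
  have iV: "inv_into V (\<iota> V) (j $ s) = v $ s" for s
    using bV v by (simp add: j_def bij_betw_def)
  have iU: "inv_into U (\<iota> U) (j $ s) = f (v $ s)" for s
  proof -
    have "f (v $ s) \<in> U" using f(1) v by blast
    then have "inv_into U (\<iota> U) (\<iota> U (f (v $ s))) = f (v $ s)"
      using bU by (simp add: bij_betw_def)
    then show ?thesis using f(2) v by (simp add: j_def)
  qed
  have "conf \<iota> U j = 0 \<longleftrightarrow> conf \<iota> V j = 0"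
    using assms(1) j unfolding equiv_c_def geq_c_def by blast
  then show ?thesis by (simp add: conf_def iV iU)
qed

lemma canonical_map_coplanar:
  assumes "V \<in> members K N S" "U \<in> members K N S"
    and "canonical_map K N S V U f" "enumeration K N S k \<iota>" "equiv_c k \<iota> V U"
    and "A \<subseteq> V"
  shows "coplanar (f ` A) \<longleftrightarrow> coplanar A"
proof -
  have det: "det (\<chi> s. homogeneous (f (v $ s))) = 0 \<longleftrightarrow> det (\<chi> s. homogeneous (v $ s)) = 0"
    if "\<And>s. v $ s \<in> A" for v :: "(real^3)^4"
    by (rule equiv_c_det[OF assms(5)])
      (use assms that in \<open>auto simp: enumeration_def canonical_map_def\<close>)
  show ?thesis
  proof
    assume L: "coplanar (f ` A)"
    show "coplanar A"
      unfolding coplanar_iff_det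
    proof (intro allI impI)
      fix v :: "(real^3)^4" assume v: "\<forall>s. v $ s \<in> A"
      show "det (\<chi> s. homogeneous (v $ s)) = 0"
        using L[unfolded coplanar_iff_det, rule_format, of "\<chi> s. f (v $ s)"] det[of v] v by simp
    qed
  next
    assume R: "coplanar A"
    show "coplanar (f ` A)"
      unfolding coplanar_iff_det
    proof (intro allI impI)
      fix u :: "(real^3)^4" assume "\<forall>s. u $ s \<in> f ` A"
      then have "\<forall>s. \<exists>a\<in>A. u $ s = f a" by blast
      then obtain a where a: "\<And>s. a s \<in> A" "\<And>s. u $ s = f (a s)" by metis
      show "det (\<chi> s. homogeneous (u $ s)) = 0"
        using R[unfolded coplanar_iff_det, rule_format, of "\<chi> s. a s"] det[of "\<chi> s. a s"] a
        by simp
    qed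
  qed
qed

section \<open>Changing the realization of a polyhedron\<close>

lemma common_face_plane_iff_coplanar:
  "(\<exists>H. face_plane r \<rho> F H \<and> face_plane r \<rho> F' H) \<longleftrightarrow>
    coplanar (\<rho> ` (vertex_set r F \<union> vertex_set r F'))"
  by (auto simp: face_plane_def coplanar_def image_Un)

lemma polyhedron_comp:
  assumes "polyhedron r \<rho>" and "inj_on f (\<rho> ` vertices r)"
    and cop: "\<And>A. A \<subseteq> \<rho> ` vertices r \<Longrightarrow> coplanar (f ` A) \<longleftrightarrow> coplanar A"
  shows "polyhedron r (f \<circ> \<rho>)"
proof -
  have cop': "coplanar ((f \<circ> \<rho>) ` X) \<longleftrightarrow> coplanar (\<rho> ` X)" if "X \<subseteq> vertices r" for X
    using cop[of "\<rho> ` X"] that by (simp add: image_comp image_mono)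
  have vs: "vertex_set r F \<subseteq> vertices r" for F by (auto simp: vertex_set_def)
  then have un: "vertex_set r F \<union> vertex_set r F' \<subseteq> vertices r" for F F' by blast
  show ?thesis
    using assms(1,2) unfolding polyhedron_def nondegenerate_def common_face_plane_iff_coplanar
    by (simp only: cop'[OF vs] cop'[OF un] comp_inj_on simp_thms) (elim conjE, intro conjI, assumption+)
qed

lemma symmetry_via_comp:
  assumes "symmetry_via r \<rho> g \<alpha>" "\<And>x. x \<in> \<rho> ` vertices r \<Longrightarrow> f (g x) = g (f x)"
  shows "symmetry_via r (f \<circ> \<rho>) g \<alpha>"
  using assms by (auto simp: symmetry_via_def)

theorem theorem3p21:
  fixes K :: refl_type
    and N :: "(real^3 \<Rightarrow> real^3) set"
    and S :: "(real \<times> real \<times> real) set"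
    and V U :: "(real^3) set"
    and f :: "real^3 \<Rightarrow> real^3"
    and k :: nat
    and \<iota> :: "(real^3) set \<Rightarrow> real^3 \<Rightarrow> nat"
    and r :: "('a \<times> 'a) set"
    and \<rho> :: "'a \<Rightarrow> real^3"
  assumes "orbit_type K N S"
    and "V \<in> members K N S" and "U \<in> members K N S"
    and "canonical_map K N S V U f"
    and "enumeration K N S k \<iota>"
    and "equiv_c k \<iota> V U"
    and "faceting r \<rho> V"
    and "\<exists>G. transitive_on_type G K N S \<and> noble_under G r \<rho>"
  shows "faceting r (f \<circ> \<rho>) U \<and> noble r (f \<circ> \<rho>)"
proof
  have poly: "polyhedron r \<rho>" and V: "\<rho> ` vertices r = V"
    using assms(7) by (auto simp: faceting_def)
  have bij: "bij_betw f V U" using canonical_map_bij[OF assms(2-5)] .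
  have "polyhedron r (f \<circ> \<rho>)"
    using polyhedron_comp[OF poly] bij canonical_map_coplanar[OF assms(2-6)] V
    by (simp add: bij_betw_def)
  moreover have "(f \<circ> \<rho>) ` vertices r = U"
    unfolding image_comp[symmetric] V using bij by (simp add: bij_betw_def)
  ultimately show "faceting r (f \<circ> \<rho>) U" by (simp add: faceting_def)
  obtain G where G: "transitive_on_type G K N S" "noble_under G r \<rho>" using assms(8) by blast
  have "\<alpha> \<in> symmetries r (f \<circ> \<rho>)" if "g \<in> G" "symmetry_via r \<rho> g \<alpha>" for g \<alpha>
    using symmetry_via_comp[OF that(2), of f] canonical_map_equivariant[OF assms(1,5,4) G(1) that(1)] V
    unfolding symmetries_def by blast
  then show "noble r (f \<circ> \<rho>)"
    using G(2) unfolding noble_under_def noble_def by metis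
qed

end
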